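(* Let $\mathcal{F}_1$ be the class of functions $f\in\mathcal{A}$ such that $\operatorname{Re}\left(f(z)/g(z)\right)>0$ for all $z\in\mathbb{D}$, for some $g\in\mathcal{A}$ with $\operatorname{Re}\left(g(z)/z\right)>0$ for all $z\in\mathbb{D}$. Then the following sharp radius results hold (i.e. each radius below is exactly equal to the stated value): (a) the $\mathcal{S}_{\mathcal{L}}$-radius of $\mathcal{F}_1$ is $R_{\mathcal{S}_{\mathcal{L}}}(\mathcal{F}_1)=\dfrac{\sqrt2-1}{2+\sqrt{7-2\sqrt2}}$; (b) for every $\beta>1$, the $\mathcal{M}(\beta)$-radius of $\mathcal{F}_1$ is $R_{\mathcal{M}(\beta)}(\mathcal{F}_1)=\dfrac{\beta-1}{2+\sqrt{4+(\beta-1)^2}}$; (c) for every $0\le\alpha<1$, the $\mathcal{S}^*(\alpha)$-radius of $\mathcal{F}_1$ is $R_{\mathcal{S}^*(\alpha)}(\mathcal{F}_1)=\dfrac{1-\alpha}{2+\sqrt{5+\alpha^2-2\alpha}}$; (d) the $\mathcal{S}_{\mathcal{P}}$-radius of $\mathcal{F}_1$ is $R_{\mathcal{S}_{\mathcal{P}}}(\mathcal{F}_1)=R_{\mathcal{S}^*(1/2)}(\mathcal{F}_1)=\dfrac{1}{4+\sqrt{17}}$.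
   Context: $\mathbb{D}=\{z\in\mathbb{C}:|z|<1\}$. $\mathcal{A}$ is the class of analytic functions $f$ on $\mathbb{D}$ with $f(0)=0$ and $f'(0)=1$; $\mathcal{S}\subset\mathcal{A}$ is the subclass of univalent (injective) functions. Quotients such as $f(z)/g(z)$, $g(z)/z$, $zf'(z)/f(z)$ with $f,g\in\mathcal{A}$ are understood at $z=0$ by their limit value $1$. For $0\le\alpha<1$, $\mathcal{S}^*(\alpha)$ is the class of $f\in\mathcal{S}$ with $\operatorname{Re}(zf'(z)/f(z))>\alpha$ on $\mathbb{D}$ (starlike of order $\alpha$). $\mathcal{S}_{\mathcal{L}}$ is the class of $f\in\mathcal{A}$ with $\left|\left(zf'(z)/f(z)\right)^2-1\right|<1$ and with $zf'(z)/f(z)$ lying in the right half of the lemniscate region, for $z\in\mathbb{D}$. For $\beta>1$, $\mathcal{M}(\beta)$ is the class of $f\in\mathcal{A}$ with $\operatorname{Re}(zf'(z)/f(z))<\beta$ on $\mathbb{D}$. $\mathcal{S}_{\mathcal{P}}$ (parabolic starlike functions) is the class of $f\in\mathcal{A}$ with $\operatorname{Re}(zf'(z)/f(z))>\left|zf'(z)/f(z)-1\right|$ on $\mathbb{D}$. For families $\mathcal{G},\mathcal{F}\subset\mathcal{A}$, the $\mathcal{G}$-radius of $\mathcal{F}$, denoted $R_{\mathcal{G}}(\mathcal{F})$, is the largest number $R$ such that the function $z\mapsto r^{-1}f(rz)$ belongs to $\mathcal{G}$ for all $0<r\le R$ and all $f\in\mathcal{F}$. *)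

theory Defs
  imports "HOL-Complex_Analysis.Complex_Analysis"
begin

abbreviation unit_disc :: "complex set" ("\<D>")
  where "\<D> \<equiv> ball 0 1"

definition class_A :: "(complex \<Rightarrow> complex) set"
  where "class_A = {f. f holomorphic_on \<D> \<and> f 0 = 0 \<and> deriv f 0 = 1}"

definition class_S :: "(complex \<Rightarrow> complex) set"
  where "class_S = {f \<in> class_A. inj_on f \<D>}"

text \<open>The functions f and g below have a simple zero with derivative 1 at the origin, so their
  quotient has the limit 1 there.\<close>

definition quot :: "(complex \<Rightarrow> complex) \<Rightarrow> (complex \<Rightarrow> complex) \<Rightarrow> complex \<Rightarrow> complex"
  where "quot f g z = (if z = 0 then 1 else f z / g z)"

definition star_quot :: "(complex \<Rightarrow> complex) \<Rightarrow> complex \<Rightarrow> complex"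
  where "star_quot f = quot (\<lambda>z. z * deriv f z) f"

definition class_Sstar :: "real \<Rightarrow> (complex \<Rightarrow> complex) set"
  where "class_Sstar \<alpha> = {f \<in> class_S. \<forall>z\<in>\<D>. Re (star_quot f z) > \<alpha>}"

definition class_SL :: "(complex \<Rightarrow> complex) set"
  where "class_SL = {f \<in> class_A. \<forall>z\<in>\<D>.
    cmod ((star_quot f z)\<^sup>2 - 1) < 1 \<and> Re (star_quot f z) > 0}"

text \<open>A zero of f away from the origin makes the totalised quotient 0, which would satisfy the
  bound on the real part at that point; hence the explicit requirement that the quotient be
  defined. In the other classes the value 0 already violates the defining inequality.\<close>

definition class_M :: "real \<Rightarrow> (complex \<Rightarrow> complex) set"
  where "class_M \<beta> = {f \<in> class_A. (\<forall>z\<in>\<D> - {0}. f z \<noteq> 0) \<and>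
    (\<forall>z\<in>\<D>. Re (star_quot f z) < \<beta>)}"

definition class_SP :: "(complex \<Rightarrow> complex) set"
  where "class_SP = {f \<in> class_A. \<forall>z\<in>\<D>.
    Re (star_quot f z) > cmod (star_quot f z - 1)}"

definition class_F1 :: "(complex \<Rightarrow> complex) set"
  where "class_F1 = {f \<in> class_A. \<exists>g\<in>class_A.
    (\<forall>z\<in>\<D>. Re (quot g (\<lambda>w. w) z) > 0) \<and> (\<forall>z\<in>\<D>. Re (quot f g z) > 0)}"

definition dilate :: "real \<Rightarrow> (complex \<Rightarrow> complex) \<Rightarrow> complex \<Rightarrow> complex"
  where "dilate r f = (\<lambda>z. f (of_real r * z) / of_real r)"

text \<open>Only radii up to 1 are admitted, since for larger r the dilated function would depend on
  values of f outside the unit disc.\<close>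

definition radius_admissible ::
    "(complex \<Rightarrow> complex) set \<Rightarrow> (complex \<Rightarrow> complex) set \<Rightarrow> real \<Rightarrow> bool"
  where "radius_admissible G F R \<longleftrightarrow>
    0 \<le> R \<and> R \<le> 1 \<and> (\<forall>r. 0 < r \<and> r \<le> R \<longrightarrow> (\<forall>f\<in>F. dilate r f \<in> G))"

text \<open>\<open>is_radius G F R\<close> says that the G-radius of F exists, i.e. that there is a largest
  admissible number, and that it equals R.\<close>

definition is_radius ::
    "(complex \<Rightarrow> complex) set \<Rightarrow> (complex \<Rightarrow> complex) set \<Rightarrow> real \<Rightarrow> bool"
  where "is_radius G F R \<longleftrightarrow>
    radius_admissible G F R \<and> (\<forall>R'. radius_admissible G F R' \<longrightarrow> R' \<le> R)"

end

theory Submission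
  imports Defs
begin

text \<open>
  A member of \<open>class_F1\<close> factors as \<open>f z = z * p z * h z\<close> with \<open>p = g / z\<close> and \<open>h = f / g\<close>, two
  holomorphic functions of positive real part. Logarithmic differentiation gives
  \<open>z f' / f - 1 = z p' / p + z h' / h\<close>. The Schwarz lemma bounds the logarithmic derivative of a
  function of positive real part by \<open>2 / (1 - r\<^sup>2)\<close> on the circle of radius \<open>r\<close>
  (\<open>Re_pos_norm_logderiv_le\<close>), so \<open>z f' / f\<close> stays in the closed disc with centre \<open>1\<close> and radius
  \<open>4 r / (1 - r\<^sup>2)\<close> (\<open>class_F1_star_quot_bound\<close>). The function \<open>z ((1 + z) / (1 - z))\<^sup>2\<close> is in the
  class, and at \<open>z = r\<close> and \<open>z = - r\<close> its quotient reaches the two real end points of this disc.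

  All the radii follow from this one picture (\<open>is_radius_class_F1\<close>). Each target class requires
  \<open>z f' / f\<close> to lie in some region; that region contains the open disc of some radius \<open>c\<close> about \<open>1\<close>
  but misses one of \<open>1 + c\<close> and \<open>1 - c\<close>. The radius is then the root \<open>r\<close> in the unit interval of
  \<open>4 r / (1 - r\<^sup>2) = c\<close>. The values of \<open>c\<close> are \<open>sqrt 2 - 1\<close> for the lemniscate, \<open>\<beta> - 1\<close> and \<open>1 - \<alpha>\<close>
  for the half-planes, and \<open>1/2\<close> for the parabola.

  Starlike functions of order \<open>\<alpha>\<close> have to be univalent as well. This holds because
  \<open>Re (z f' / f) > 0\<close> forces univalence (\<open>starlike_inj_on\<close>): in the coordinate \<open>log z\<close>, which ranges
  over a half-plane, \<open>log f\<close> has a derivative with positive real part.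
\<close>

section \<open>Univalence of starlike functions\<close>

text \<open>The Noshiro--Warschawski criterion: if \<open>F a = F b\<close>, then by the mean value theorem along the
  segment the real part of \<open>F / (b - a)\<close> has a critical point there, and its derivative in the
  direction \<open>b - a\<close> is \<open>Re F'\<close>.\<close>

lemma inj_on_convex_if_Re_deriv_pos:
  assumes "convex S"
    and der: "\<And>z. z \<in> S \<Longrightarrow> (F has_field_derivative F' z) (at z)"
    and pos: "\<And>z. z \<in> S \<Longrightarrow> Re (F' z) > 0"
  shows "inj_on F S"
proof (rule inj_onI, rule ccontr)
  fix a b assume ab: "a \<in> S" "b \<in> S" "F a = F b" "a \<noteq> b"
  have seg: "closed_segment a b \<subseteq> S"
    using \<open>convex S\<close> ab by (simp add: closed_segment_subset)
  have "\<And>u. u \<in> closed_segment a b \<Longrightarrow>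
      ((\<lambda>z. F z / (b - a)) has_field_derivative F' u / (b - a)) (at u)"
    using seg by (intro DERIV_cdivide der) auto
  from complex_mvt_line[OF this] obtain u where
    u: "u \<in> closed_segment a b"
      "Re (F b / (b - a)) - Re (F a / (b - a)) = Re (F' u / (b - a) * (b - a))"
    by blast
  then have "Re (F' u) = 0"
    using ab by simp
  then show False
    using pos[of u] seg u by auto
qed

lemma quot_id_holomorphic:
  assumes "f \<in> class_A"
  shows "quot f (\<lambda>w. w) holomorphic_on \<D>"
proof (rule pole_theorem_open_0[where a = 0 and g = f])
  show "f holomorphic_on \<D>" "f 0 = 0" "quot f (\<lambda>w. w) 0 = deriv f 0"
    using assms by (auto simp: class_A_def quot_def)
qed (auto simp: quot_def)

lemma times_quot_id:
  assumes "f \<in> class_A"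
  shows "f z = z * quot f (\<lambda>w. w) z"
  using assms by (auto simp: class_A_def quot_def)

text \<open>The removable singularity of \<open>z f' / f\<close> at the origin disappears when the zero of \<open>f\<close> is split
  off; the formula covers \<open>z = 0\<close> too.\<close>

lemma star_quot_factorised:
  assumes q: "q holomorphic_on \<D>" and nz: "\<And>z. z \<in> \<D> \<Longrightarrow> q z \<noteq> 0"
    and f: "\<And>z. z \<in> \<D> \<Longrightarrow> f z = z * q z" and z: "z \<in> \<D>"
  shows "star_quot f z = 1 + z * (deriv q z / q z)"
proof -
  have "(q has_field_derivative deriv q z) (at z)"
    using q z holomorphic_derivI[OF q] by simp
  then have "((\<lambda>z. z * q z) has_field_derivative (q z + z * deriv q z)) (at z)"
    by (auto intro!: derivative_eq_intros)
  then have "(f has_field_derivative (q z + z * deriv q z)) (at z)"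
    by (rule has_field_derivative_transform_within_open[of _ _ _ \<D>]) (use z f in auto)
  then show ?thesis
    using nz[OF z] f[OF z]
    by (auto simp: star_quot_def quot_def DERIV_imp_deriv field_simps)
qed

text \<open>Write \<open>f z = z exp (k z)\<close>. The lift \<open>F \<zeta> = \<zeta> + k (exp \<zeta>)\<close> of \<open>log f\<close> to the left half-plane has the
  derivative \<open>z f' / f\<close> at \<open>z = exp \<zeta>\<close>, so it is injective by the preceding criterion. Since \<open>F\<close>
  commutes with translation by \<open>2 \<pi> \<i>\<close>, equal values of \<open>f\<close> come from points \<open>\<zeta>\<close> that differ by a
  multiple of \<open>2 \<pi> \<i>\<close>, hence from the same \<open>z\<close>.\<close>

lemma starlike_inj_on:
  assumes f: "f \<in> class_A" and pos: "\<And>z. z \<in> \<D> \<Longrightarrow> Re (star_quot f z) > 0"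
  shows "inj_on f \<D>"
proof -
  let ?q = "quot f (\<lambda>w. w)"
  have nz: "f z \<noteq> 0" if "z \<in> \<D>" "z \<noteq> 0" for z
    \<comment> \<open>at a zero the totalised quotient has the value 0, which is not positive\<close>
    using pos[OF that(1)] that(2) by (auto simp: star_quot_def quot_def)
  then have "?q z \<noteq> 0" if "z \<in> \<D>" for z
    using that by (auto simp: quot_def)
  then obtain k where k: "k holomorphic_on \<D>" "\<And>z. z \<in> \<D> \<Longrightarrow> exp (k z) = ?q z"
    using holomorphic_logarithm_exists[OF convex_ball open_ball quot_id_holomorphic[OF f], of 0]
    by (metis centre_in_ball zero_less_one)
  have fk: "f z = z * exp (k z)" if "z \<in> \<D>" for z
    using times_quot_id[OF f] k(2)[OF that] by simp
  have kder: "(k has_field_derivative deriv k z) (at z)" if "z \<in> \<D>" for z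
    using holomorphic_derivI[OF k(1) _ that] by simp
  have sq: "star_quot f z = 1 + z * deriv k z" if "z \<in> \<D>" for z
  proof -
    have "((\<lambda>z. exp (k z)) has_field_derivative exp (k z) * deriv k z) (at z)"
      by (auto intro!: derivative_eq_intros kder that)
    then have "deriv (\<lambda>z. exp (k z)) z = exp (k z) * deriv k z"
      by (rule DERIV_imp_deriv)
    moreover have "(\<lambda>z. exp (k z)) holomorphic_on \<D>"
      by (intro holomorphic_intros k)
    ultimately show ?thesis
      using star_quot_factorised[of "\<lambda>z. exp (k z)" f z] fk that by simp
  qed
  define H where "H = {\<zeta>::complex. Re \<zeta> < 0}"
  define F where "F = (\<lambda>\<zeta>. \<zeta> + k (exp \<zeta>))"
  have expH: "exp \<zeta> \<in> \<D> \<longleftrightarrow> \<zeta> \<in> H" for \<zeta>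
    by (simp add: H_def)
  have "inj_on F H"
  proof (rule inj_on_convex_if_Re_deriv_pos)
    show "convex H"
      unfolding H_def by (rule convex_halfspace_Re_lt)
    show "(F has_field_derivative star_quot f (exp \<zeta>)) (at \<zeta>)"
      and "Re (star_quot f (exp \<zeta>)) > 0" if "\<zeta> \<in> H" for \<zeta>
    proof -
      have "exp \<zeta> \<in> \<D>" using that expH by simp
      then show "Re (star_quot f (exp \<zeta>)) > 0" by (rule pos)
      show "(F has_field_derivative star_quot f (exp \<zeta>)) (at \<zeta>)"
        unfolding F_def sq[OF \<open>exp \<zeta> \<in> \<D>\<close>]
        by (auto intro!: derivative_eq_intros DERIV_chain2[where f = k and g = exp, OF kder[OF \<open>exp \<zeta> \<in> \<D>\<close>]])
    qed
  qed
  show ?thesis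
  proof (rule inj_onI)
    fix z w assume zw: "z \<in> \<D>" "w \<in> \<D>" "f z = f w"
    show "z = w"
    proof (cases "z = 0 \<or> w = 0")
      case True
      then show ?thesis
        using zw nz[of z] nz[of w] f by (force simp: class_A_def)
    next
      case False
      then have ez: "exp (Ln z) = z" "exp (Ln w) = w" by auto
      then have H: "Ln z \<in> H" "Ln w \<in> H"
        using zw expH by metis+
      have "exp (F (Ln z)) = exp (F (Ln w))"
        using zw fk ez by (simp add: F_def exp_add)
      then obtain n :: int where n: "F (Ln z) = F (Ln w) + of_int (2 * n) * pi * \<i>"
        unfolding exp_eq by blast
      let ?v = "Ln w + of_int (2 * n) * pi * \<i>"
      have ev: "exp ?v = w"
        using ez exp_eq[of ?v "Ln w"] by auto
      have "F (Ln z) = F ?v"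
        unfolding n unfolding F_def ev ez by (simp add: algebra_simps)
      moreover have "?v \<in> H"
        using H(2) by (simp add: H_def)
      ultimately have "Ln z = ?v"
        using \<open>inj_on F H\<close> H by (auto dest: inj_onD)
      then show ?thesis
        using ev ez by metis
    qed
  qed
qed

section \<open>The logarithmic derivative of a function with positive real part\<close>

lemma norm_diff_less_norm_add_cnj:
  assumes "Re w > 0" "Re b > 0"
  shows "cmod (w - b) < cmod (w + cnj b)"
proof -
  have "(Re w - Re b)\<^sup>2 < (Re w + Re b)\<^sup>2"
    using mult_pos_pos[OF assms] by (simp add: power2_eq_square algebra_simps)
  then show ?thesis
    by (simp add: cmod_def)
qed

text \<open>An invariant form of the Schwarz lemma. A Moebius map of the disc moves \<open>a\<close> to the origin and a
  Cayley map takes the right half-plane to the disc and \<open>p a\<close> to the origin; the resulting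
  self-map of the disc has the derivative \<open>p' a (1 - \<bar>a\<bar>\<^sup>2) / (2 Re (p a))\<close> at the origin.\<close>

lemma Re_pos_norm_deriv_le:
  assumes hol: "p holomorphic_on \<D>" and pos: "\<And>z. z \<in> \<D> \<Longrightarrow> Re (p z) > 0" and a: "a \<in> \<D>"
  shows "cmod (deriv p a) \<le> 2 * Re (p a) / (1 - (cmod a)\<^sup>2)"
proof -
  define \<phi> where "\<phi> = Moebius_function 0 (-a)"
  define q where "q = (\<lambda>\<zeta>. (p (\<phi> \<zeta>) - p a) / (p (\<phi> \<zeta>) + cnj (p a)))"
  have na: "cmod (- a) < 1" using a by simp
  have \<phi>D: "\<phi> \<zeta> \<in> \<D>" if "\<zeta> \<in> \<D>" for \<zeta>
    using Moebius_function_norm_lt_1[OF na, of \<zeta> 0] that by (simp add: \<phi>_def)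
  have \<phi>0: "\<phi> 0 = a"
    by (simp add: \<phi>_def Moebius_function_simple)
  have \<phi>hol: "\<phi> holomorphic_on \<D>"
    unfolding \<phi>_def by (rule Moebius_function_holomorphic[OF na])
  have nz: "p z + cnj (p a) \<noteq> 0" if "z \<in> \<D>" for z
    using pos[OF that] pos[OF a] by (auto simp: complex_eq_iff)
  have phol: "(\<lambda>\<zeta>. p (\<phi> \<zeta>)) holomorphic_on \<D>"
    using holomorphic_on_compose_gen[OF \<phi>hol hol image_subsetI[OF \<phi>D]] by (simp add: o_def)
  have "q holomorphic_on \<D>"
    unfolding q_def by (intro holomorphic_intros phol nz \<phi>D)
  moreover have "q 0 = 0" by (simp add: q_def \<phi>0)
  moreover have "cmod (q \<zeta>) < 1" if "cmod \<zeta> < 1" for \<zeta>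
  proof -
    have \<zeta>: "\<phi> \<zeta> \<in> \<D>" using \<phi>D that by simp
    show ?thesis
      using norm_diff_less_norm_add_cnj[OF pos[OF \<zeta>] pos[OF a]] nz[OF \<zeta>]
      by (simp add: q_def norm_divide)
  qed
  ultimately have schwarz: "cmod (deriv q 0) \<le> 1"
    using Schwarz_Lemma(2)[of q 0] by simp
  let ?d = "complex_of_real (1 - (cmod a)\<^sup>2)" and ?b = "complex_of_real (2 * Re (p a))"
  have b: "p a + cnj (p a) = ?b" "?b \<noteq> 0"
    using pos[OF a] complex_add_cnj[of "p a"] by auto
  have "(\<phi> has_field_derivative ?d) (at 0)"
    unfolding \<phi>_def Moebius_function_simple[abs_def]
    by (auto intro!: derivative_eq_intros simp: complex_mult_cnj cmod_def power2_eq_square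
        complex_eq_iff)
  moreover have "(p has_field_derivative deriv p a) (at (\<phi> 0))"
    unfolding \<phi>0 using holomorphic_derivI[OF hol _ a] by simp
  ultimately have pd: "((\<lambda>\<zeta>. p (\<phi> \<zeta>)) has_field_derivative deriv p a * ?d) (at 0)"
    by (rule DERIV_chain2[rotated])
  have "(q has_field_derivative deriv p a * ?d / ?b) (at 0)"
    unfolding q_def
    by (rule derivative_eq_intros pd refl)+ (use b in \<open>auto simp: \<phi>0 field_simps\<close>)
  then have "deriv q 0 = deriv p a * ?d / ?b"
    by (rule DERIV_imp_deriv)
  moreover have d: "1 - (cmod a)\<^sup>2 > 0"
    using a by (simp add: power_less_one_iff)
  ultimately have "cmod (deriv p a) * (1 - (cmod a)\<^sup>2) / (2 * Re (p a)) \<le> 1"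
    using schwarz pos[OF a] by (simp only: norm_divide norm_mult norm_of_real)
  then show ?thesis
    using d pos[OF a] by (simp add: field_simps)
qed

lemma Re_pos_norm_logderiv_le:
  assumes "p holomorphic_on \<D>" "\<And>z. z \<in> \<D> \<Longrightarrow> Re (p z) > 0" "z \<in> \<D>"
  shows "cmod (deriv p z / p z) \<le> 2 / (1 - (cmod z)\<^sup>2)"
proof -
  have d: "1 - (cmod z)\<^sup>2 > 0"
    using assms(3) by (simp add: power_less_one_iff)
  have "cmod (p z) > 0"
    using assms(2)[OF assms(3)] by auto
  moreover have "cmod (deriv p z) \<le> 2 * cmod (p z) / (1 - (cmod z)\<^sup>2)"
    using Re_pos_norm_deriv_le[OF assms] d complex_Re_le_cmod[of "p z"]
    by (smt (verit) divide_right_mono)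
  ultimately show ?thesis
    using d by (simp add: norm_divide field_simps)
qed

section \<open>The sharp disc containing \<open>z f' / f\<close>\<close>

lemma class_F1_factorisation:
  assumes "f \<in> class_F1"
  obtains p h where "p holomorphic_on \<D>" "h holomorphic_on \<D>"
    "\<And>z. z \<in> \<D> \<Longrightarrow> Re (p z) > 0" "\<And>z. z \<in> \<D> \<Longrightarrow> Re (h z) > 0"
    "\<And>z. z \<in> \<D> \<Longrightarrow> f z = z * (p z * h z)"
proof -
  from assms obtain g where g: "g \<in> class_A" and f: "f \<in> class_A"
    and p: "\<And>z. z \<in> \<D> \<Longrightarrow> Re (quot g (\<lambda>w. w) z) > 0"
    and h: "\<And>z. z \<in> \<D> \<Longrightarrow> Re (quot f g z) > 0"
    by (auto simp: class_F1_def)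
  have pnz: "quot g (\<lambda>w. w) z \<noteq> 0" if "z \<in> \<D>" for z
    using p[OF that] by auto
  have h_eq: "quot f g z = quot f (\<lambda>w. w) z / quot g (\<lambda>w. w) z" for z
    by (auto simp: quot_def)
  show ?thesis
  proof (rule that[of "quot g (\<lambda>w. w)" "quot f g"])
    show "quot f g holomorphic_on \<D>"
      unfolding h_eq[abs_def]
      by (intro holomorphic_intros quot_id_holomorphic f g pnz)
    show "f z = z * (quot g (\<lambda>w. w) z * quot f g z)" if "z \<in> \<D>" for z
      using times_quot_id[OF f, of z] pnz[OF that] by (simp add: h_eq)
  qed (use p h quot_id_holomorphic[OF g] in auto)
qed

lemma class_F1_nonzero:
  assumes "f \<in> class_F1" "z \<in> \<D>" "z \<noteq> 0"
  shows "f z \<noteq> 0"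
  using assms by (elim class_F1_factorisation) (metis less_irrefl mult_eq_0_iff zero_complex.sel(1))

text \<open>Each of the two factors of positive real part contributes at most \<open>2 r / (1 - r\<^sup>2)\<close>.\<close>

lemma class_F1_star_quot_bound:
  assumes "f \<in> class_F1" and z: "z \<in> \<D>"
  shows "cmod (star_quot f z - 1) \<le> 4 * cmod z / (1 - (cmod z)\<^sup>2)"
proof -
  obtain p h where hol: "p holomorphic_on \<D>" "h holomorphic_on \<D>"
    and pos: "\<And>z. z \<in> \<D> \<Longrightarrow> Re (p z) > 0" "\<And>z. z \<in> \<D> \<Longrightarrow> Re (h z) > 0"
    and f: "\<And>z. z \<in> \<D> \<Longrightarrow> f z = z * (p z * h z)"
    using class_F1_factorisation[OF assms(1)] by metis
  have nz: "p z \<noteq> 0" "h z \<noteq> 0" if "z \<in> \<D>" for z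
    using pos[OF that] by auto
  have "((\<lambda>z. p z * h z) has_field_derivative deriv p z * h z + deriv h z * p z) (at z)"
    by (intro DERIV_mult holomorphic_derivI[OF hol(1) _ z] holomorphic_derivI[OF hol(2) _ z]) auto
  then have "deriv (\<lambda>z. p z * h z) z = deriv p z * h z + deriv h z * p z"
    by (rule DERIV_imp_deriv)
  moreover have "star_quot f z = 1 + z * (deriv (\<lambda>z. p z * h z) z / (p z * h z))"
    by (rule star_quot_factorised) (use hol nz f z in \<open>auto intro!: holomorphic_intros\<close>)
  ultimately have "star_quot f z - 1 = z * (deriv p z / p z + deriv h z / h z)"
    using nz[OF z] by (simp add: field_simps)
  then have "cmod (star_quot f z - 1) \<le> cmod z * (2 / (1 - (cmod z)\<^sup>2) + 2 / (1 - (cmod z)\<^sup>2))"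
    using Re_pos_norm_logderiv_le[OF hol(1) pos(1) z] Re_pos_norm_logderiv_le[OF hol(2) pos(2) z]
      norm_triangle_ineq[of "deriv p z / p z" "deriv h z / h z"]
    by (simp only: norm_mult) (intro mult_left_mono, auto)
  then show ?thesis
    by (simp add: field_simps)
qed

text \<open>Both factors are the Cayley map, for which the bound on the logarithmic derivative is attained
  at every real point.\<close>

definition extremal :: "complex \<Rightarrow> complex"
  where "extremal z = z * ((1 + z) / (1 - z))\<^sup>2"

lemma Re_cayley_pos:
  assumes "z \<in> \<D>"
  shows "Re ((1 + z) / (1 - z)) > 0"
proof -
  have "z \<noteq> 1" using assms by auto
  have "(Re z)\<^sup>2 + (Im z)\<^sup>2 < 1"
    using assms by (simp add: cmod_def)
  then have "Re ((1 + z) * cnj (1 - z)) > 0"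
    by (simp add: algebra_simps power2_eq_square)
  then show ?thesis
    using \<open>z \<noteq> 1\<close> by (simp add: complex_div_cnj[of "1 + z" "1 - z"] del: complex_cnj_diff)
qed

lemma id_times_in_class_A:
  assumes q: "q holomorphic_on \<D>" and "q 0 = 1"
  shows "(\<lambda>z. z * q z) \<in> class_A"
proof -
  have "(q has_field_derivative deriv q 0) (at 0)"
    using holomorphic_derivI[OF q] by simp
  then have "((\<lambda>z. z * q z) has_field_derivative 1) (at 0)"
    using \<open>q 0 = 1\<close> by (auto intro!: derivative_eq_intros)
  then show ?thesis
    using q by (auto simp: class_A_def DERIV_imp_deriv intro!: holomorphic_intros)
qed

lemma extremal_in_class_F1: "extremal \<in> class_F1"
proof -
  let ?c = "\<lambda>z::complex. (1 + z) / (1 - z)"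
  let ?g = "\<lambda>z. z * ?c z"
  have hol: "?c holomorphic_on \<D>"
    by (intro holomorphic_intros) auto
  have cnz: "?c z \<noteq> 0" if "z \<in> \<D>" for z
    using Re_cayley_pos[OF that] by auto
  have "?g \<in> class_A"
    by (rule id_times_in_class_A[OF hol]) simp
  moreover have "extremal \<in> class_A"
    unfolding extremal_def[abs_def]
    by (rule id_times_in_class_A) (auto intro!: holomorphic_intros)
  moreover have "Re (quot ?g (\<lambda>w. w) z) > 0" if "z \<in> \<D>" for z
    using Re_cayley_pos[OF that] by (simp add: quot_def)
  moreover have "Re (quot extremal ?g z) > 0" if "z \<in> \<D>" for z
  proof (cases "z = 0")
    case False
    then have "extremal z / ?g z = ?c z"
      using cnz[OF that] unfolding extremal_def power2_eq_square mult.assoc[symmetric]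
      by (intro nonzero_mult_div_cancel_left) simp
    then show ?thesis
      using Re_cayley_pos[OF that] False by (simp only: quot_def if_False)
  qed (simp add: quot_def)
  ultimately show ?thesis
    unfolding class_F1_def by blast
qed

lemma star_quot_extremal:
  assumes z: "z \<in> \<D>"
  shows "star_quot extremal z = 1 + 4 * z / (1 - z\<^sup>2)"
proof -
  let ?q = "\<lambda>z::complex. ((1 + z) / (1 - z))\<^sup>2"
  have ne: "1 + w \<noteq> 0" "1 - w \<noteq> 0" if "w \<in> \<D>" for w :: complex
  proof -
    show "1 + w \<noteq> 0" using that by (metis add_eq_0_iff less_irrefl mem_ball_0 norm_minus_cancel norm_one)
    show "1 - w \<noteq> 0" using that by auto
  qed
  have "(?q has_field_derivative 4 * (1 + z) / (1 - z) ^ 3) (at z)"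
    using ne[OF z]
    by (auto intro!: derivative_eq_intros simp: divide_simps power2_eq_square power3_eq_cube)
       (simp add: algebra_simps)
  then have "deriv ?q z = 4 * (1 + z) / (1 - z) ^ 3"
    by (rule DERIV_imp_deriv)
  moreover have "star_quot extremal z = 1 + z * (deriv ?q z / ?q z)"
    by (rule star_quot_factorised)
       (use z ne in \<open>auto simp: extremal_def intro!: holomorphic_intros\<close>)
  moreover have "1 - z\<^sup>2 = (1 + z) * (1 - z)"
    by (simp add: power2_eq_square algebra_simps)
  moreover have "4 * (1 + z) / (1 - z) ^ 3 / ?q z = 4 / ((1 + z) * (1 - z))"
    using ne[OF z] by (simp add: divide_simps power2_eq_square power3_eq_cube)
  ultimately show ?thesis
    by (metis (no_types, lifting) times_divide_eq_right mult.commute)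
qed

section \<open>Dilations and radii\<close>

lemma dilate_class_A:
  assumes f: "f \<in> class_A" and r: "0 < r" "r \<le> 1"
  shows "dilate r f \<in> class_A"
    and "z \<in> \<D> \<Longrightarrow> star_quot (dilate r f) z = star_quot f (of_real r * z)"
proof -
  have rD: "of_real r * z \<in> \<D>" if "z \<in> \<D>" for z :: complex
    using that r mult_left_le_one_le[of "cmod z" r]
    by (simp add: norm_mult)
  have hol: "f holomorphic_on \<D>" and f0: "f 0 = 0" "deriv f 0 = 1"
    using f by (auto simp: class_A_def)
  have der: "(dilate r f has_field_derivative deriv f (of_real r * z)) (at z)" if "z \<in> \<D>" for z
  proof -
    have "(f has_field_derivative deriv f (of_real r * z)) (at (of_real r * z))"
      using holomorphic_derivI[OF hol _ rD[OF that]] by simp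
    then have "((\<lambda>z. f (of_real r * z)) has_field_derivative deriv f (of_real r * z) * of_real r) (at z)"
      by (rule DERIV_chain2) (auto intro!: derivative_eq_intros)
    from DERIV_cdivide[OF this, of "of_real r"] show ?thesis
      using r by (simp add: dilate_def)
  qed
  have "dilate r f holomorphic_on \<D>"
    using der by (meson holomorphic_on_open open_ball)
  moreover have "dilate r f 0 = 0"
    using f0 by (simp add: dilate_def)
  ultimately show "dilate r f \<in> class_A"
    using f0 DERIV_imp_deriv[OF der[of 0]] by (simp add: class_A_def)
  show "star_quot (dilate r f) z = star_quot f (of_real r * z)" if "z \<in> \<D>"
    using DERIV_imp_deriv[OF der[OF that]] r by (simp add: star_quot_def quot_def dilate_def)
qed

text \<open>The root in the unit interval of \<open>4 r / (1 - r\<^sup>2) = c\<close>, rationalised so that the denominator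
  does not vanish with \<open>c\<close>.\<close>

definition rho :: "real \<Rightarrow> real"
  where "rho c = c / (2 + sqrt (4 + c\<^sup>2))"

lemma rho_solves:
  assumes "c > 0"
  shows "0 < rho c" "rho c < 1" "4 * rho c / (1 - (rho c)\<^sup>2) = c"
proof -
  define s where "s = sqrt (4 + c\<^sup>2)"
  have s2: "s\<^sup>2 = 4 + c\<^sup>2" and s0: "s \<ge> 0" unfolding s_def by auto
  have sc: "c < s"
    unfolding s_def using assms by (intro real_less_rsqrt) simp
  show "0 < rho c" "rho c < 1"
    using assms sc by (auto simp: rho_def s_def[symmetric])
  have "(2 + s)\<^sup>2 - c\<^sup>2 = 4 * (2 + s)"
    using s2 by (simp add: power2_eq_square algebra_simps)
  moreover have "1 - (rho c)\<^sup>2 = ((2 + s)\<^sup>2 - c\<^sup>2) / (2 + s)\<^sup>2"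
    using s0 by (simp add: rho_def s_def[symmetric] power_divide diff_divide_distrib)
  ultimately show "4 * rho c / (1 - (rho c)\<^sup>2) = c"
    using s0 unfolding rho_def s_def[symmetric]
    by (simp add: divide_simps) (simp add: power2_eq_square algebra_simps)
qed

text \<open>On a disc of radius at most \<open>rho c\<close> the quotient \<open>z f' / f\<close> is strictly closer to \<open>1\<close> than \<open>c\<close>,
  because the open disc does not reach the circle on which the bound equals \<open>c\<close>. As soon as the
  radius exceeds \<open>rho c\<close>, the point \<open>s * rho c\<close> is inside the disc, and there the quotient of the
  extremal function is the forbidden value \<open>1 + s * c\<close>. The sign \<open>s\<close> says on which side the target
  region touches the disc.\<close>

lemma is_radius_class_F1:
  assumes c: "c > 0"
    and inside: "\<And>F. F \<in> class_A \<Longrightarrow> (\<And>z. z \<in> \<D> - {0} \<Longrightarrow> F z \<noteq> 0) \<Longrightarrow>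
      (\<And>z. z \<in> \<D> \<Longrightarrow> cmod (star_quot F z - 1) < c) \<Longrightarrow> F \<in> G"
    and s: "s = 1 \<or> s = -1"
    and avoid: "\<And>F z. F \<in> G \<Longrightarrow> z \<in> \<D> \<Longrightarrow> star_quot F z \<noteq> of_real (1 + s * c)"
  shows "is_radius G class_F1 (rho c)"
proof -
  note R = rho_solves[OF c]
  have "dilate r f \<in> G" if r: "0 < r" "r \<le> rho c" and f: "f \<in> class_F1" for r f
  proof (rule inside)
    have fA: "f \<in> class_A" using f by (auto simp: class_F1_def)
    have r1: "r \<le> 1" using r R by simp
    show "dilate r f \<in> class_A"
      using dilate_class_A(1)[OF fA] r r1 by simp
    have small: "cmod (of_real r * z) < rho c" if "z \<in> \<D>" for z
    proof -
      have "r * cmod z < r * 1"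
        using that r by (intro mult_strict_left_mono) auto
      also have "\<dots> \<le> rho c" using r by simp
      finally have "r * cmod z < rho c" .
      then show ?thesis using r by (simp add: norm_mult)
    qed
    show "dilate r f z \<noteq> 0" if "z \<in> \<D> - {0}" for z
      using class_F1_nonzero[OF f, of "of_real r * z"] small[of z] that r R
      by (auto simp: dilate_def)
    show "cmod (star_quot (dilate r f) z - 1) < c" if z: "z \<in> \<D>" for z
    proof -
      let ?t = "cmod (of_real r * z)"
      have t: "?t < rho c" by (rule small[OF z])
      then have "of_real r * z \<in> \<D>" using R by simp
      then have "cmod (star_quot (dilate r f) z - 1) \<le> 4 * ?t / (1 - ?t\<^sup>2)"
        using dilate_class_A(2)[OF fA r(1) r1 z] class_F1_star_quot_bound[OF f] by metis
      also have "\<dots> < 4 * rho c / (1 - (rho c)\<^sup>2)"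
      proof (rule frac_less)
        show "1 - (rho c)\<^sup>2 \<le> 1 - ?t\<^sup>2"
          using t by (simp add: power_mono)
        show "0 < 1 - (rho c)\<^sup>2"
          using R by (simp add: power_less_one_iff)
      qed (use t in auto)
      finally show ?thesis using R by simp
    qed
  qed
  then have "radius_admissible G class_F1 (rho c)"
    using R by (simp add: radius_admissible_def)
  moreover have "R' \<le> rho c" if adm: "radius_admissible G class_F1 R'" for R'
  proof (rule ccontr)
    assume "\<not> R' \<le> rho c"
    then have R': "rho c < R'" "0 < R'" "R' \<le> 1"
      using adm R by (auto simp: radius_admissible_def)
    define x where "x = s * rho c"
    define z where "z = complex_of_real (x / R')"
    have z: "z \<in> \<D>"
      using R' R s by (auto simp: z_def x_def norm_divide norm_mult)
    have Rz: "of_real R' * z = complex_of_real x"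
      using R' by (simp add: z_def)
    have xD: "complex_of_real x \<in> \<D>"
      using R s by (auto simp: x_def norm_mult)
    have "dilate R' extremal \<in> G"
      using adm R' extremal_in_class_F1 by (auto simp: radius_admissible_def)
    moreover have "star_quot (dilate R' extremal) z = of_real (1 + s * c)"
    proof -
      have "star_quot (dilate R' extremal) z = star_quot extremal (of_real x)"
        using dilate_class_A(2)[OF _ R'(2,3) z, of extremal] extremal_in_class_F1 Rz
        by (simp add: class_F1_def)
      also have "\<dots> = of_real (1 + 4 * x / (1 - x\<^sup>2))"
        using star_quot_extremal[OF xD] by simp
      also have "4 * x / (1 - x\<^sup>2) = s * (4 * rho c / (1 - (rho c)\<^sup>2))"
        using s by (auto simp: x_def)
      finally show ?thesis using R by simp
    qed
    ultimately show False
      using avoid z by blast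
  qed
  ultimately show ?thesis
    by (simp add: is_radius_def)
qed

section \<open>The radii of the individual classes\<close>

text \<open>The disc fits into the lemniscate region because
  \<open>\<bar>w\<^sup>2 - 1\<bar> = \<bar>w - 1\<bar> \<bar>w + 1\<bar> < (sqrt 2 - 1) (sqrt 2 + 1) = 1\<close>; it touches the vertex \<open>sqrt 2\<close>.\<close>

lemma radius_SL: "is_radius class_SL class_F1 (rho (sqrt 2 - 1))"
proof (rule is_radius_class_F1[where s = 1])
  fix F assume F: "F \<in> class_A"
    and small: "\<And>z. z \<in> \<D> \<Longrightarrow> cmod (star_quot F z - 1) < sqrt 2 - 1"
  have "cmod (w\<^sup>2 - 1) < 1 \<and> Re w > 0" if w: "cmod (w - 1) < sqrt 2 - 1" for w :: complex
  proof
    have "cmod (w + 1) \<le> cmod (w - 1) + 2"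
      using norm_triangle_ineq[of "w - 1" 2] by (simp add: algebra_simps)
    then have "cmod (w + 1) \<le> sqrt 2 + 1"
      using w by simp
    then have "cmod (w - 1) * cmod (w + 1) \<le> cmod (w - 1) * (sqrt 2 + 1)"
      by (intro mult_left_mono) auto
    also have "\<dots> < (sqrt 2 - 1) * (sqrt 2 + 1)"
      using w by (intro mult_strict_right_mono) (auto simp: add_pos_pos)
    also have "\<dots> = 1" by (simp add: algebra_simps)
    finally show "cmod (w\<^sup>2 - 1) < 1"
      by (simp add: norm_mult[symmetric] power2_eq_square algebra_simps)
    have "sqrt 2 < 2" using real_sqrt_less_iff[of 2 4] by simp
    then show "Re w > 0"
      using w abs_Re_le_cmod[of "w - 1"] by auto
  qed
  then show "F \<in> class_SL"
    using F small by (auto simp: class_SL_def)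
next
  fix F z assume "F \<in> class_SL" "z \<in> \<D>"
  then have "cmod ((star_quot F z)\<^sup>2 - 1) < 1"
    by (simp add: class_SL_def)
  moreover have "cmod ((complex_of_real (sqrt 2))\<^sup>2 - 1) = 1"
    by (simp flip: of_real_power)
  ultimately show "star_quot F z \<noteq> complex_of_real (1 + 1 * (sqrt 2 - 1))"
    by auto
qed auto

lemma radius_M:
  assumes "\<beta> > 1"
  shows "is_radius (class_M \<beta>) class_F1 (rho (\<beta> - 1))"
proof (rule is_radius_class_F1[where s = 1])
  fix F assume F: "F \<in> class_A" "\<And>z. z \<in> \<D> - {0} \<Longrightarrow> F z \<noteq> 0"
    and small: "\<And>z. z \<in> \<D> \<Longrightarrow> cmod (star_quot F z - 1) < \<beta> - 1"
  have "Re (star_quot F z) < \<beta>" if "z \<in> \<D>" for z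
    using small[OF that] complex_Re_le_cmod[of "star_quot F z - 1"] by simp
  then show "F \<in> class_M \<beta>"
    using F by (simp add: class_M_def)
next
  fix F z assume "F \<in> class_M \<beta>" "z \<in> \<D>"
  then have "Re (star_quot F z) < \<beta>"
    by (simp add: class_M_def)
  then show "star_quot F z \<noteq> complex_of_real (1 + 1 * (\<beta> - 1))"
    by auto
qed (use assms in auto)

lemma radius_Sstar:
  assumes "0 \<le> \<alpha>" "\<alpha> < 1"
  shows "is_radius (class_Sstar \<alpha>) class_F1 (rho (1 - \<alpha>))"
proof (rule is_radius_class_F1[where s = "-1"])
  fix F assume F: "F \<in> class_A"
    and small: "\<And>z. z \<in> \<D> \<Longrightarrow> cmod (star_quot F z - 1) < 1 - \<alpha>"
  have Re: "Re (star_quot F z) > \<alpha>" if "z \<in> \<D>" for z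
    using small[OF that] abs_Re_le_cmod[of "star_quot F z - 1"] by simp
  then have "inj_on F \<D>"
    using assms by (intro starlike_inj_on F) force
  then show "F \<in> class_Sstar \<alpha>"
    using F Re by (simp add: class_Sstar_def class_S_def)
next
  fix F z assume "F \<in> class_Sstar \<alpha>" "z \<in> \<D>"
  then have "Re (star_quot F z) > \<alpha>"
    by (simp add: class_Sstar_def)
  then show "star_quot F z \<noteq> complex_of_real (1 + - 1 * (1 - \<alpha>))"
    by auto
qed (use assms in auto)

text \<open>In the disc of radius \<open>1/2\<close> about \<open>1\<close> one has \<open>\<bar>w - 1\<bar> < 1/2 < Re w\<close>, and its leftmost point
  \<open>1/2\<close> is the vertex of the parabola. So the parabolic class has the same radius as the
  starlike functions of order \<open>1/2\<close>.\<close>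

lemma radius_SP: "is_radius class_SP class_F1 (rho (1/2))"
proof (rule is_radius_class_F1[where s = "-1"])
  fix F assume F: "F \<in> class_A"
    and small: "\<And>z. z \<in> \<D> \<Longrightarrow> cmod (star_quot F z - 1) < 1/2"
  have "Re (star_quot F z) > cmod (star_quot F z - 1)" if "z \<in> \<D>" for z
    using small[OF that] abs_Re_le_cmod[of "star_quot F z - 1"] by simp
  then show "F \<in> class_SP"
    using F by (simp add: class_SP_def)
next
  fix F z assume "F \<in> class_SP" "z \<in> \<D>"
  then have "Re (star_quot F z) > cmod (star_quot F z - 1)"
    by (simp add: class_SP_def)
  moreover have "cmod (complex_of_real (1 / 2) - of_real 1) = \<bar>1 / 2 - 1\<bar>"
    by (simp only: of_real_diff[symmetric] norm_of_real)
  then have "cmod (w - 1) = 1 / 2 \<and> Re w = 1 / 2" if "w = complex_of_real (1 / 2)" for w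
    unfolding that by (simp only: Re_complex_of_real) simp
  ultimately have "star_quot F z \<noteq> complex_of_real (1 / 2)"
    by (metis less_irrefl)
  then show "star_quot F z \<noteq> complex_of_real (1 + - 1 * (1 / 2))"
    by simp
qed auto

lemma rho_half: "rho (1/2) = 1 / (4 + sqrt 17)"
proof -
  have "sqrt (4 + (1/2)\<^sup>2) = sqrt 17 / 2"
    by (simp add: real_sqrt_divide power2_eq_square real_sqrt_unique)
  then show ?thesis
    by (simp add: rho_def field_simps)
qed

theorem theorem2p1:
  shows "is_radius class_SL class_F1 ((sqrt 2 - 1) / (2 + sqrt (7 - 2 * sqrt 2)))
    \<and> (\<forall>\<beta>::real. \<beta> > 1 \<longrightarrow>
        is_radius (class_M \<beta>) class_F1 ((\<beta> - 1) / (2 + sqrt (4 + (\<beta> - 1)\<^sup>2))))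
    \<and> (\<forall>\<alpha>::real. 0 \<le> \<alpha> \<and> \<alpha> < 1 \<longrightarrow>
        is_radius (class_Sstar \<alpha>) class_F1 ((1 - \<alpha>) / (2 + sqrt (5 + \<alpha>\<^sup>2 - 2 * \<alpha>))))
    \<and> is_radius class_SP class_F1 (1 / (4 + sqrt 17))
    \<and> is_radius (class_Sstar (1/2)) class_F1 (1 / (4 + sqrt 17))"
proof (intro conjI allI impI)
  have "4 + (sqrt 2 - 1)\<^sup>2 = 7 - 2 * sqrt 2"
    by (simp add: power2_eq_square algebra_simps)
  then show "is_radius class_SL class_F1 ((sqrt 2 - 1) / (2 + sqrt (7 - 2 * sqrt 2)))"
    using radius_SL by (simp add: rho_def)
  show "is_radius (class_M \<beta>) class_F1 ((\<beta> - 1) / (2 + sqrt (4 + (\<beta> - 1)\<^sup>2)))"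
    if "\<beta> > 1" for \<beta> :: real
    using radius_M[OF that] by (simp add: rho_def)
  show "is_radius (class_Sstar \<alpha>) class_F1 ((1 - \<alpha>) / (2 + sqrt (5 + \<alpha>\<^sup>2 - 2 * \<alpha>)))"
    if "0 \<le> \<alpha> \<and> \<alpha> < 1" for \<alpha> :: real
  proof -
    have "4 + (1 - \<alpha>)\<^sup>2 = 5 + \<alpha>\<^sup>2 - 2 * \<alpha>"
      by (simp add: power2_eq_square algebra_simps)
    then show ?thesis
      using radius_Sstar[of \<alpha>] that unfolding rho_def by metis
  qed
  show "is_radius class_SP class_F1 (1 / (4 + sqrt 17))"
    using radius_SP by (simp add: rho_half)
  show "is_radius (class_Sstar (1/2)) class_F1 (1 / (4 + sqrt 17))"
    using radius_Sstar[of "1/2"] by (simp add: rho_half)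
qed

end
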